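(* Let $q$ be a complex number with $0<|q|<1$, and set $$A_7:=\frac{\varphi(-q)\varphi(-q^7)}{q^{8}\psi(q^8)\psi(q^{56})},\qquad B_7:=\frac{\varphi(-q)\psi(q^{56})}{q^{-6}\varphi(-q^7)\psi(q^8)}.$$ Then $$\begin{aligned} B^4_7+\frac{1}{B^4_7}={}&280\left(B^3_7+\frac{1}{B^3_7}\right)+9772\left(B^2_7+\frac{1}{B^2_7}\right)+60424\left(B_7+\frac{1}{B_7}\right)\\ &+\left(A_7^3+\frac{8^6}{A_7^3}\right)+\left(A_7^2+\frac{8^4}{A_7^2}\right)\left[203+84\left(B_7+\frac{1}{B_7}\right)\right]\\ &+28\left(\sqrt{A_7}+\frac{8}{\sqrt{A_7}}\right)\left[1030\left(\sqrt{B_7}+\frac{1}{\sqrt{B_7}}\right)+313\left(\sqrt{B^3_7}+\frac{1}{\sqrt{B^3_7}}\right)+21\left(\sqrt{B^5_7}+\frac{1}{\sqrt{B^5_7}}\right)\right]\\ &+140\left(\sqrt{A_7^3}+\frac{8^3}{\sqrt{A_7^3}}\right)\left[9\left(\sqrt{B_7}+\frac{1}{\sqrt{B_7}}\right)+2\left(\sqrt{B^3_7}+\frac{1}{\sqrt{B^3_7}}\right)\right]\\ &+\left(A_7+\frac{8^2}{A_7}\right)\left[8092+4340\left(B_7+\frac{1}{B_7}\right)+546\left(B^2_7+\frac{1}{B^2_7}\right)\right]\\ &+14\left(\sqrt{A_7^5}+\frac{8^5}{\sqrt{A_7^5}}\right)\left(\sqrt{B_7}+\frac{1}{\sqrt{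B_7}}\right)+106330.\end{aligned}$$
   Context: For $|q|<1$, $\varphi(q)=\sum_{m=-\infty}^{\infty}q^{m^2}$ and $\psi(q)=\sum_{m=0}^{\infty}q^{m(m+1)/2}$. The square roots $\sqrt{A_7},\sqrt{B_7}$ are chosen so that $\sqrt{A_7}\sqrt{B_7}=\dfrac{\varphi(-q)}{q\psi(q^8)}$, and $\sqrt{A_7^j}=(\sqrt{A_7})^j$, $\sqrt{B_7^j}=(\sqrt{B_7})^j$ for odd $j$; for $0<q<1$, $A_7$ and $B_7$ are positive and these are the positive square roots. *)

theory Defs
  imports "HOL-Analysis.Analysis"
begin

text \<open>
  Ramanujan's theta functions, meaningful for \<open>norm q < 1\<close>, where both series converge
  absolutely.  In the bilateral series the exponent \<open>m\<^sup>2\<close> is a nonnegative integer, so the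
  conversion \<^const>\<open>nat\<close> loses nothing.
\<close>

definition theta_phi :: "complex \<Rightarrow> complex" where
  "theta_phi q = (\<Sum>\<^sub>\<infinity>m\<in>(UNIV :: int set). q ^ nat (m\<^sup>2))"

definition theta_psi :: "complex \<Rightarrow> complex" where
  "theta_psi q = (\<Sum>m. q ^ (m * (m + 1) div 2))"

definition A7 :: "complex \<Rightarrow> complex" where
  "A7 q = theta_phi (- q) * theta_phi (- (q ^ 7))
          / (q ^ 8 * theta_psi (q ^ 8) * theta_psi (q ^ 56))"

definition B7 :: "complex \<Rightarrow> complex" where
  "B7 q = theta_phi (- q) * theta_psi (q ^ 56)
          / (q powi (- 6) * theta_phi (- (q ^ 7)) * theta_psi (q ^ 8))"

text \<open>
  A choice of square roots \<open>a\<close> of \<open>A7 q\<close> and \<open>b\<close> of \<open>B7 q\<close> is admissible if their product has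
  the prescribed value.  This fixes the pair up to a simultaneous change of sign; for
  \<open>0 < q < 1\<close> the positive square roots form one of the two admissible pairs.
\<close>

definition admissible_roots :: "complex \<Rightarrow> complex \<Rightarrow> complex \<Rightarrow> bool" where
  "admissible_roots q a b \<longleftrightarrow>
     a\<^sup>2 = A7 q \<and> b\<^sup>2 = B7 q \<and> a * b = theta_phi (- q) / (q * theta_psi (q ^ 8))"

end

theory Submission
  imports Defs
begin

text \<open>
  With \<open>P = \<phi>(-q) / (q \<psi>(q\<^sup>8))\<close> and \<open>Q\<close> the same quotient at \<open>q\<^sup>7\<close>, one has \<open>A\<^sub>7 = P Q\<close>,
  \<open>B\<^sub>7 = P / Q\<close>, and the assertion is a polynomial relation between \<open>P\<close> and \<open>Q\<close>.  It is the
  rationalised form of Guetzlaff's modular equation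
  \<open>(\<alpha>\<beta>)\<^bsup>1/8\<^esup> + ((1-\<alpha>)(1-\<beta>))\<^bsup>1/8\<^esup> = 1\<close> of degree 7, whose branch-free theta version is
  \<open>\<phi>(q)\<phi>(q\<^sup>7) - \<phi>(-q\<^sup>2)\<phi>(-q\<^bsup>14\<^esup>) = 2q \<psi>(q)\<psi>(q\<^sup>7)\<close>.  The latter follows from the theta series \<open>S\<close> of
  the norm form \<open>a\<^sup>2 + a b + 2 b\<^sup>2\<close> of the ring of integers of \<open>\<rat>(\<surd>-7)\<close>, where 2 splits: splitting
  \<open>S\<close> by the parity of \<open>b\<close> separates off the order \<open>\<int>[\<surd>-7]\<close>, and splitting it by the parity of
  \<open>a\<close> separates off the multiples of a prime above 2, which contribute \<open>S(q\<^sup>2)\<close>.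
\<close>

section \<open>Unordered sums of powers of q over integers and pairs of integers\<close>

text \<open>Exponents are integers so that linear changes of variables may pass through negative
  values. The exponents it is applied to are nonnegative, so \<open>nat\<close> does not truncate
  them.\<close>

definition qsum :: "complex \<Rightarrow> ('a \<Rightarrow> int) \<Rightarrow> 'a set \<Rightarrow> complex" where
  "qsum q f A = (\<Sum>\<^sub>\<infinity>x\<in>A. q ^ nat (f x))"

lemma summable_power_abs_int:
  fixes r :: real
  assumes "0 \<le> r" "r < 1"
  shows "(\<lambda>n::int. r ^ nat \<bar>n\<bar>) summable_on UNIV"
proof -
  have *: "(\<lambda>n::nat. r ^ n) summable_on UNIV"
    using assms by (intro norm_summable_imp_summable_on) (auto simp: norm_power)
  have 1: "(\<lambda>n::int. r ^ nat \<bar>n\<bar>) summable_on {0..}"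
    by (subst summable_on_reindex_bij_witness[where i = int and j = nat and T = UNIV and h = "\<lambda>n. r ^ n"])
       (use * in auto)
  have "(\<lambda>n::int. r ^ nat \<bar>n\<bar>) summable_on {..0}"
    by (subst summable_on_reindex_bij_witness[where i = "\<lambda>n. - int n" and j = "\<lambda>n. nat (-n)" and T = UNIV and h = "\<lambda>n. r ^ n"])
       (use * in \<open>auto simp: abs_if\<close>)
  then have 2: "(\<lambda>n::int. r ^ nat \<bar>n\<bar>) summable_on {..<0}"
    by (rule summable_on_subset_banach) auto
  have "UNIV = {0..} \<union> {..<0::int}" by auto
  then show ?thesis
    using summable_on_Un_disjoint[OF 1 2] by (simp add: disjoint_iff)
qed

lemma summable_power_abs_int2:
  fixes r :: real
  assumes "0 \<le> r" "r < 1"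
  shows "(\<lambda>(m::int, n::int). r ^ nat (\<bar>m\<bar> + \<bar>n\<bar>)) summable_on UNIV"
proof -
  have "(\<lambda>(m::int, n::int). r ^ nat \<bar>m\<bar> * r ^ nat \<bar>n\<bar>) summable_on UNIV \<times> UNIV"
    by (rule summable_on_SigmaI[where g = "\<lambda>m. r ^ nat \<bar>m\<bar> * (\<Sum>\<^sub>\<infinity>n. r ^ nat \<bar>n::int\<bar>)"])
       (use assms summable_power_abs_int[OF assms] in
         \<open>auto intro!: has_sum_cmult_right summable_on_cmult_left has_sum_infsum\<close>)
  then show ?thesis
    by (simp add: nat_add_distrib power_add case_prod_unfold)
qed

text \<open>The slack \<open>k\<close> is there because triangular exponents can drop below
  \<open>\<bar>n\<bar>\<close>: at n = -1 the exponent is 0. Each variable costs a slack of 1, hence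
  2 for pairs.\<close>

lemma norm_power_nat_le:
  fixes q :: complex
  assumes q: "q \<noteq> 0" "norm q < 1" and le: "w \<le> f + int k"
  shows "norm (q ^ nat f) \<le> norm q ^ nat w * inverse (norm q ^ k)"
proof -
  have "norm q ^ (nat f + k) \<le> norm q ^ nat w"
    using q le by (intro power_decreasing) auto
  then show ?thesis
    using q by (simp add: norm_power power_add field_simps)
qed

lemma summable_qsum:
  fixes q :: complex and f :: "int \<Rightarrow> int"
  assumes q: "q \<noteq> 0" "norm q < 1" and le: "\<And>x. \<bar>x\<bar> \<le> f x + 1"
  shows "(\<lambda>x. q ^ nat (f x)) summable_on A"
proof (rule Infinite_Sum.abs_summable_summable, rule Infinite_Sum.abs_summable_on_comparison_test')
  show "(\<lambda>x. norm q ^ nat \<bar>x\<bar> * inverse (norm q ^ 1)) summable_on A"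
    using summable_on_subset_banach[OF summable_power_abs_int[of "norm q"]] q
    by (intro summable_on_cmult_left) auto
qed (use norm_power_nat_le[OF q, where k = 1] le in auto)

lemma summable_qsum2:
  fixes q :: complex and f :: "int \<times> int \<Rightarrow> int"
  assumes q: "q \<noteq> 0" "norm q < 1" and le: "\<And>x y. \<bar>x\<bar> + \<bar>y\<bar> \<le> f (x, y) + 2"
  shows "(\<lambda>p. q ^ nat (f p)) summable_on A"
proof (rule Infinite_Sum.abs_summable_summable, rule Infinite_Sum.abs_summable_on_comparison_test')
  show "(\<lambda>p. (case p of (x, y) \<Rightarrow> norm q ^ nat (\<bar>x\<bar> + \<bar>y\<bar>)) * inverse (norm q ^ 2)) summable_on A"
    using summable_on_subset_banach[OF summable_power_abs_int2[of "norm q"]] q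
    by (intro summable_on_cmult_left) auto
  fix p :: "int \<times> int"
  show "norm (q ^ nat (f p)) \<le> (case p of (x, y) \<Rightarrow> norm q ^ nat (\<bar>x\<bar> + \<bar>y\<bar>)) * inverse (norm q ^ 2)"
    using norm_power_nat_le[OF q, of "\<bar>fst p\<bar> + \<bar>snd p\<bar>" "f p" 2] le[of "fst p" "snd p"]
    by (auto simp: case_prod_unfold)
qed

lemma qsum_reindex:
  assumes "\<And>a. a \<in> S \<Longrightarrow> i (j a) = a" "\<And>a. a \<in> S \<Longrightarrow> j a \<in> T"
    "\<And>b. b \<in> T \<Longrightarrow> j (i b) = b" "\<And>b. b \<in> T \<Longrightarrow> i b \<in> S"
    "\<And>b. b \<in> T \<Longrightarrow> f (i b) = g b"
  shows "qsum q f S = qsum q g T"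
  unfolding qsum_def using assms
  by (intro infsum_reindex_bij_witness[where i = i and j = j]) (auto, metis)

lemma qsum_split:
  assumes "(\<lambda>x. q ^ nat (f x)) summable_on UNIV"
  shows "qsum q f UNIV = qsum q f {x. P x} + qsum q f {x. \<not> P x}"
proof -
  have "UNIV = {x. P x} \<union> {x. \<not> P x}" by auto
  then show ?thesis
    using infsum_Un_disjoint[of "\<lambda>x. q ^ nat (f x)" "{x. P x}" "{x. \<not> P x}"]
      summable_on_subset_banach[OF assms]
    unfolding qsum_def by auto
qed

text \<open>On the sublattice of index 2 where x + y is even, (x - y)/2 and (x + y)/2 are integer
  coordinates; these diagonalise the sums of two squares or two triangular numbers used below. The
  next lemma treats the other coset.\<close>

lemma qsum_even_sum:
  fixes f :: "int \<times> int \<Rightarrow> int"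
  shows "qsum q f {p. even (fst p + snd p)} = qsum q (\<lambda>(s, t). f (s + t, t - s)) UNIV"
proof (rule qsum_reindex[where i = "\<lambda>(s, t). (s + t, t - s)" and j = "\<lambda>(x, y). ((x - y) div 2, (x + y) div 2)"])
  show "(case case p of (x, y) \<Rightarrow> ((x - y) div 2, (x + y) div 2) of (s, t) \<Rightarrow> (s + t, t - s)) = p"
    if "p \<in> {p. even (fst p + snd p)}" for p :: "int \<times> int"
    using that by (cases p) (simp, presburger)
qed (auto simp: algebra_simps)

lemma qsum_odd_sum:
  fixes f :: "int \<times> int \<Rightarrow> int"
  shows "qsum q f {p. odd (fst p + snd p)} = qsum q (\<lambda>(s, t). f (s + t + 1, t - s)) UNIV"
proof (rule qsum_reindex[where i = "\<lambda>(s, t). (s + t + 1, t - s)" and j = "\<lambda>(x, y). ((x - y) div 2, (x + y) div 2)"])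
  show "(case case p of (x, y) \<Rightarrow> ((x - y) div 2, (x + y) div 2) of (s, t) \<Rightarrow> (s + t + 1, t - s)) = p"
    if "p \<in> {p. odd (fst p + snd p)}" for p :: "int \<times> int"
    using that by (cases p) (simp, presburger)
qed (auto simp: algebra_simps)

lemma qsum_mult:
  fixes q :: complex and f g :: "int \<Rightarrow> int"
  assumes q: "q \<noteq> 0" "norm q < 1"
    and f: "\<And>x. \<bar>x\<bar> \<le> f x + 1" "\<And>x. 0 \<le> f x"
    and g: "\<And>x. \<bar>x\<bar> \<le> g x + 1" "\<And>x. 0 \<le> g x"
  shows "qsum q f UNIV * qsum q g UNIV = qsum q (\<lambda>(x, y). f x + g y) UNIV"
proof -
  have le: "\<bar>x\<bar> + \<bar>y\<bar> \<le> (case (x, y) of (x, y) \<Rightarrow> f x + g y) + 2" for x y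
    using f(1)[of x] g(1)[of y] by auto
  have "(\<lambda>p. q ^ nat (case p of (x, y) \<Rightarrow> f x + g y)) summable_on UNIV \<times> UNIV"
    using summable_qsum2[OF q le] by simp
  then have sm: "(\<lambda>(x, y). q ^ nat (f x) * q ^ nat (g y)) summable_on UNIV \<times> UNIV"
    using f(2) g(2) by (simp add: case_prod_unfold nat_add_distrib power_add)
  show ?thesis
    unfolding qsum_def using f(2) g(2) infsum_Sigma'_banach[OF sm]
    by (simp add: case_prod_unfold nat_add_distrib power_add infsum_cmult_right' infsum_cmult_left')
qed

lemma qsum_power: "qsum (q ^ k) f A = qsum q (\<lambda>x. int k * f x) A"
  by (simp add: qsum_def power_mult[symmetric] nat_mult_distrib)

lemma qsum_shift:
  assumes "\<And>x. 0 \<le> f x"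
  shows "qsum q (\<lambda>x. f x + int k) A = q ^ k * qsum q f A"
  using assms by (simp add: qsum_def nat_add_distrib power_add infsum_cmult_right' mult.commute)

lemma power_in_disc:
  fixes q :: complex
  assumes "q \<noteq> 0" "norm q < 1"
  shows "q ^ k \<noteq> 0" "0 < k \<Longrightarrow> norm (q ^ k) < 1"
  using assms by (auto simp: norm_power power_less_one_iff)

section \<open>Triangular numbers; both theta functions as bilateral sums\<close>

lemma abs_le_square_int: "\<bar>x\<bar> \<le> (x::int)\<^sup>2"
proof (cases "x = 0")
  case False
  then have "1 * \<bar>x\<bar> \<le> \<bar>x\<bar> * \<bar>x\<bar>" by (intro mult_right_mono) auto
  then show ?thesis by (simp add: power2_eq_square)
qed auto

text \<open>Defined on all integers, so that psi too becomes a sum over a full lattice.\<close>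

definition tri :: "int \<Rightarrow> int" where
  "tri n = n * (n + 1) div 2"

lemma two_tri: "2 * tri n = n\<^sup>2 + n"
  unfolding tri_def by (simp add: power2_eq_square algebra_simps)

lemma tri_nonneg: "0 \<le> tri n"
  using two_tri[of n] abs_le_square_int[of n] by linarith

lemma abs_le_tri: "\<bar>n\<bar> \<le> tri n + 1"
proof -
  \<comment> \<open>The right-hand side is 2 tri(n-1) + 2 for n >= 0 and 2 tri(n+1) for n <
    0.\<close>
  have "0 \<le> 2 * tri n + 2 - 2 * \<bar>n\<bar>"
    using two_tri[of n] two_tri[of "-n-1"] two_tri[of "n-1"] tri_nonneg[of "n - 2"] two_tri[of "n - 2"]
      tri_nonneg[of "n + 1"] two_tri[of "n + 1"] tri_nonneg[of "n-1"]
    by (auto simp: abs_if power2_eq_square algebra_simps)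
  then show ?thesis by linarith
qed

lemma abs_le_mult:
  assumes "0 < (k::nat)" "0 \<le> x" "\<bar>n\<bar> \<le> x + 1"
  shows "\<bar>n\<bar> \<le> int k * x + 1"
proof -
  have "1 * x \<le> int k * x" using assms by (intro mult_right_mono) auto
  then show ?thesis using assms by linarith
qed

lemmas coercive = abs_le_mult[OF _ zero_le_power2 order.trans[OF abs_le_square_int]]
  abs_le_mult[OF _ tri_nonneg abs_le_tri]

lemma theta_phi_eq: "theta_phi q = qsum q (\<lambda>m. m\<^sup>2) UNIV"
  by (simp add: theta_phi_def qsum_def)

text \<open>The reflection n -> -1-n preserves \<open>tri\<close> and exchanges negative and
  nonnegative integers, so every term of psi occurs twice.\<close>

lemma two_theta_psi_eq:
  assumes q: "q \<noteq> 0" "norm q < 1"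
  shows "2 * theta_psi q = qsum q tri UNIV"
proof -
  have sm: "(\<lambda>x. q ^ nat (tri x)) summable_on A" for A
    by (rule summable_qsum[OF q abs_le_tri])
  have nat_eq: "nat (tri (int n)) = n * (n + 1) div 2" for n
    by (metis nat_int of_nat_1 of_nat_add of_nat_mult of_nat_numeral tri_def zdiv_int)
  have *: "qsum q tri {0..} = theta_psi q"
  proof -
    have 1: "qsum q tri {0..} = qsum q (\<lambda>n. tri (int n)) UNIV"
      by (rule qsum_reindex[where i = int and j = nat]) auto
    have "(\<lambda>n. q ^ nat (tri (int n))) summable_on UNIV"
      using sm[of "{0..}"]
        summable_on_reindex_bij_witness[of "{0::int..}" int nat UNIV "\<lambda>n. q ^ nat (tri (int n))" "\<lambda>x. q ^ nat (tri x)"]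
      by auto
    from has_sum_imp_sums[OF has_sum_infsum[OF this]]
    show ?thesis unfolding 1 unfolding qsum_def theta_psi_def nat_eq by (simp add: sums_iff)
  qed
  have "qsum q tri UNIV = qsum q tri {x. 0 \<le> x} + qsum q tri {x. \<not> 0 \<le> x}"
    by (rule qsum_split[OF sm])
  also have "qsum q tri {x. \<not> 0 \<le> x} = qsum q tri {0..}"
    by (rule qsum_reindex[where i = "\<lambda>x. - 1 - x" and j = "\<lambda>x. - 1 - x"])
       (auto simp: tri_def algebra_simps)
  also have "{x. 0 \<le> x} = {0::int..}" by auto
  finally show ?thesis using * by simp
qed

section \<open>Dissections and squares of phi and psi\<close>

context
  fixes q :: complex
  assumes q: "q \<noteq> 0" "norm q < 1"
begin

lemma phi_phi:
  assumes "0 < j" "0 < k"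
  shows "theta_phi (q ^ j) * theta_phi (q ^ k) = qsum q (\<lambda>(x, y). int j * x\<^sup>2 + int k * y\<^sup>2) UNIV"
  unfolding theta_phi_eq qsum_power
  by (rule qsum_mult[OF q]) (use assms in \<open>auto intro!: coercive\<close>)

lemma phi_psi:
  assumes "0 < j" "0 < k"
  shows "2 * (theta_phi (q ^ j) * theta_psi (q ^ k)) = qsum q (\<lambda>(x, y). int j * x\<^sup>2 + int k * tri y) UNIV"
proof -
  have "theta_phi (q ^ j) * (2 * theta_psi (q ^ k)) = qsum q (\<lambda>(x, y). int j * x\<^sup>2 + int k * tri y) UNIV"
    unfolding theta_phi_eq two_theta_psi_eq[OF power_in_disc(1)[OF q] power_in_disc(2)[OF q assms(2)]] qsum_power
    by (rule qsum_mult[OF q]) (use assms in \<open>auto intro!: coercive mult_nonneg_nonneg tri_nonneg\<close>)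
  then show ?thesis by (simp add: algebra_simps)
qed

lemma psi_psi:
  assumes "0 < j" "0 < k"
  shows "4 * (theta_psi (q ^ j) * theta_psi (q ^ k)) = qsum q (\<lambda>(x, y). int j * tri x + int k * tri y) UNIV"
proof -
  have "(2 * theta_psi (q ^ j)) * (2 * theta_psi (q ^ k)) = qsum q (\<lambda>(x, y). int j * tri x + int k * tri y) UNIV"
    unfolding two_theta_psi_eq[OF power_in_disc(1)[OF q] power_in_disc(2)[OF q assms(1)]]
      two_theta_psi_eq[OF power_in_disc(1)[OF q] power_in_disc(2)[OF q assms(2)]] qsum_power
    by (rule qsum_mult[OF q]) (use assms in \<open>auto intro!: coercive mult_nonneg_nonneg tri_nonneg\<close>)
  then show ?thesis by (simp add: algebra_simps)
qed

text \<open>Split by the parity of the index; odd squares are (2x+1)^2 = 8 tri(x) + 1.\<close>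

lemma theta_phi_dissect: "theta_phi q = theta_phi (q ^ 4) + 2 * q * theta_psi (q ^ 8)"
proof -
  have sm: "(\<lambda>x::int. q ^ nat (x\<^sup>2)) summable_on UNIV"
    by (rule summable_qsum[OF q]) (simp add: abs_le_square_int add_increasing2)
  have e: "qsum q (\<lambda>x. x\<^sup>2) {x. even x} = theta_phi (q ^ 4)"
    unfolding theta_phi_eq qsum_power
    by (rule qsum_reindex[where i = "\<lambda>x. 2 * x" and j = "\<lambda>x. x div 2"]) (auto simp: power2_eq_square)
  have eq: "(2 * x + 1)\<^sup>2 = 8 * tri x + 1" for x
    using two_tri[of x] by (simp add: power2_eq_square algebra_simps)
  have "qsum q (\<lambda>x. x\<^sup>2) {x. odd x} = qsum q (\<lambda>x. int 8 * tri x + int 1) UNIV"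
    by (rule qsum_reindex[where i = "\<lambda>x. 2 * x + 1" and j = "\<lambda>x. x div 2"])
       (auto simp: eq elim!: oddE)
  also have "\<dots> = q ^ 1 * (2 * theta_psi (q ^ 8))"
    unfolding two_theta_psi_eq[OF power_in_disc(1)[OF q] power_in_disc(2)[OF q, of 8, simplified]] qsum_power
    by (rule qsum_shift) (use tri_nonneg in auto)
  finally show ?thesis
    using qsum_split[OF sm, of even] e by (simp add: theta_phi_eq)
qed

text \<open>In the rotated coordinates tri(x) + tri(y) becomes s^2 + 2 tri(t) on the even class.
  Reflecting x -> -1-x carries one parity class of x + y to the other, so both contribute
  equally.\<close>

lemma theta_psi_square: "(theta_psi q)\<^sup>2 = theta_phi q * theta_psi (q\<^sup>2)"
proof -
  define f where "f = (\<lambda>(x, y). tri x + tri y)"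
  have sm: "(\<lambda>p. q ^ nat (f p)) summable_on UNIV"
  proof (rule summable_qsum2[OF q])
    show "\<bar>m\<bar> + \<bar>n\<bar> \<le> f (m, n) + 2" for m n
      using abs_le_tri[of m] abs_le_tri[of n] by (simp add: f_def)
  qed
  have eq: "f (s + t, t - s) = s\<^sup>2 + 2 * tri t" for s t
    using two_tri[of "s + t"] two_tri[of "t - s"] two_tri[of t]
    by (simp add: f_def power2_eq_square algebra_simps)
  have 1: "qsum q f {p. even (fst p + snd p)} = qsum q (\<lambda>(s, t). s\<^sup>2 + 2 * tri t) UNIV"
    unfolding qsum_even_sum by (simp add: eq)
  have 2: "qsum q f {p. \<not> even (fst p + snd p)} = qsum q f {p. even (fst p + snd p)}"
    by (rule qsum_reindex[where i = "\<lambda>(x, y). (- 1 - x, y)" and j = "\<lambda>(x, y). (- 1 - x, y)"])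
       (auto simp: f_def tri_def algebra_simps)
  have "4 * (theta_psi (q ^ 1) * theta_psi (q ^ 1)) = qsum q f UNIV"
    unfolding f_def using psi_psi[of 1 1] by simp
  also have "\<dots> = 2 * qsum q (\<lambda>(s, t). s\<^sup>2 + 2 * tri t) UNIV"
    using qsum_split[OF sm, of "\<lambda>p. even (fst p + snd p)"] 1 2 by simp
  also have "\<dots> = 4 * (theta_phi (q ^ 1) * theta_psi (q ^ 2))"
    using phi_psi[of 1 2] by simp
  finally show ?thesis by (simp add: power2_eq_square)
qed

text \<open>For x^2 + y^2 the even class gives 2s^2 + 2t^2 and the odd class 4 tri(s) + 4 tri(t) +
  1.\<close>

lemma theta_phi_square: "(theta_phi q)\<^sup>2 = (theta_phi (q\<^sup>2))\<^sup>2 + 4 * q * (theta_psi (q ^ 4))\<^sup>2"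
proof -
  define f where "f = (\<lambda>(x, y). x\<^sup>2 + y\<^sup>2 :: int)"
  have sm: "(\<lambda>p. q ^ nat (f p)) summable_on UNIV"
  proof (rule summable_qsum2[OF q])
    show "\<bar>m\<bar> + \<bar>n\<bar> \<le> f (m, n) + 2" for m n
      using abs_le_square_int[of m] abs_le_square_int[of n] by (simp add: f_def)
  qed
  have 1: "qsum q f {p. even (fst p + snd p)} = qsum q (\<lambda>(s, t). 2 * s\<^sup>2 + 2 * t\<^sup>2) UNIV"
    unfolding qsum_even_sum by (simp add: f_def power2_eq_square algebra_simps)
  have eq: "f (s + t + 1, t - s) = 4 * tri s + 4 * tri t + 1" for s t
    using two_tri[of s] two_tri[of t] by (simp add: f_def power2_eq_square algebra_simps)
  have "qsum q f {p. \<not> even (fst p + snd p)} = qsum q (\<lambda>p. (case p of (s, t) \<Rightarrow> 4 * tri s + 4 * tri t) + int 1) UNIV"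
    unfolding qsum_odd_sum by (simp add: eq case_prod_unfold)
  also have "\<dots> = q ^ 1 * qsum q (\<lambda>(s, t). 4 * tri s + 4 * tri t) UNIV"
    by (rule qsum_shift) (use tri_nonneg in auto)
  also have "\<dots> = 4 * q * (theta_psi (q ^ 4))\<^sup>2"
    using psi_psi[of 4 4] by (simp add: power2_eq_square)
  finally have 2: "qsum q f {p. \<not> even (fst p + snd p)} = 4 * q * (theta_psi (q ^ 4))\<^sup>2" .
  have "(theta_phi (q ^ 1))\<^sup>2 = qsum q f UNIV"
    unfolding f_def power2_eq_square[of "theta_phi _"] using phi_phi[of 1 1] by simp
  also have "\<dots> = (theta_phi (q\<^sup>2))\<^sup>2 + 4 * q * (theta_psi (q ^ 4))\<^sup>2"
    using qsum_split[OF sm, of "\<lambda>p. even (fst p + snd p)"] 1 2 phi_phi[of 2 2]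
    by (simp add: power2_eq_square)
  finally show ?thesis by simp
qed


end

section \<open>The theta series S of a^2 + ab + 2b^2\<close>

definition binary_theta :: "complex \<Rightarrow> complex" where
  "binary_theta q = qsum q (\<lambda>(a, b). a\<^sup>2 + a * b + 2 * b\<^sup>2) UNIV"

text \<open>Twice the form is (a+b)^2 + a^2 + 3b^2.\<close>

lemma abs_add_le_form: "\<bar>a\<bar> + \<bar>b\<bar> \<le> a\<^sup>2 + a * b + 2 * b\<^sup>2 + (2::int)"
proof -
  have "2 * \<bar>a\<bar> \<le> a\<^sup>2 + 1"
    using zero_le_power2[of "\<bar>a\<bar> - 1"] unfolding power2_diff power2_abs by simp
  moreover have "0 \<le> a\<^sup>2 + 2 * (a * b) + b\<^sup>2"
    using zero_le_power2[of "a + b"] unfolding power2_sum by simp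
  ultimately show ?thesis using abs_le_square_int[of b] by linarith
qed

lemma tri_reflect: "tri (- 1 - n) = tri n"
  by (simp add: tri_def algebra_simps)

context
  fixes q :: complex
  assumes q: "q \<noteq> 0" "norm q < 1"
begin

lemma form_summable: "(\<lambda>p. q ^ nat (case p of (a, b) \<Rightarrow> a\<^sup>2 + a * b + 2 * b\<^sup>2)) summable_on UNIV"
  by (rule summable_qsum2[OF q], unfold prod.case) (rule abs_add_le_form)

text \<open>The form is (a + b/2)^2 + 7(b/2)^2. For b = 2n, m = a + n it is m^2 + 7n^2; for b = 2n+1
  both squares are of half-integers, which gives triangular numbers.\<close>

lemma binary_theta_parity_snd:
  "binary_theta q = theta_phi q * theta_phi (q ^ 7) + 4 * q\<^sup>2 * (theta_psi (q\<^sup>2) * theta_psi (q ^ 14))"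
proof -
  let ?f = "\<lambda>(a, b). a\<^sup>2 + a * b + 2 * b\<^sup>2 :: int"
  have 1: "qsum q ?f {p. even (snd p)} = theta_phi (q ^ 1) * theta_phi (q ^ 7)"
    unfolding phi_phi[OF q zero_less_one zero_less_numeral]
    by (rule qsum_reindex[where i = "\<lambda>(m, n). (m - n, 2 * n)" and j = "\<lambda>(a, b). (a + b div 2, b div 2)"])
       (auto simp: power2_eq_square algebra_simps)
  have eq: "(m - n)\<^sup>2 + (m - n) * (2 * n + 1) + 2 * (2 * n + 1)\<^sup>2 = 2 * tri m + 14 * tri n + 2" for m n
    using two_tri[of m] two_tri[of n] by (simp add: power2_eq_square algebra_simps)
  have "qsum q ?f {p. \<not> even (snd p)} = qsum q (\<lambda>p. (case p of (m, n) \<Rightarrow> 2 * tri m + 14 * tri n) + int 2) UNIV"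
    by (rule qsum_reindex[where i = "\<lambda>(m, n). (m - n, 2 * n + 1)" and j = "\<lambda>(a, b). (a + b div 2, b div 2)"])
       (auto simp: eq elim!: oddE)
  also have "\<dots> = q\<^sup>2 * qsum q (\<lambda>(m, n). 2 * tri m + 14 * tri n) UNIV"
    by (rule qsum_shift) (use tri_nonneg in auto)
  also have "\<dots> = 4 * q\<^sup>2 * (theta_psi (q\<^sup>2) * theta_psi (q ^ 14))"
    using psi_psi[OF q, of 2 14] by simp
  finally show ?thesis
    using qsum_split[OF form_summable, of "\<lambda>p. even (snd p)"] 1 by (simp add: binary_theta_def)
qed

text \<open>Putting a = 2b', b = a' doubles the form in (a', b'), whence S(q^2). For odd a, write
  the form as ((a+4b)^2 + 7a^2)/8, a combination of odd squares.\<close>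

lemma binary_theta_parity_fst:
  "binary_theta q = binary_theta (q\<^sup>2) + 2 * q * (theta_psi q * theta_psi (q ^ 7))"
proof -
  let ?f = "\<lambda>(a, b). a\<^sup>2 + a * b + 2 * b\<^sup>2 :: int"
  \<comment> \<open>With a = 2k+1 the form is g(k+2b, k). These arguments are the pairs of even sum,
    half of the lattice; the reflection n -> -1-n supplies the other half.\<close>
  define g where "g = (\<lambda>(m, n). tri m + 7 * tri n + 1)"
  have 1: "qsum q ?f {p. even (fst p)} = binary_theta (q\<^sup>2)"
    unfolding binary_theta_def qsum_power
    by (rule qsum_reindex[where i = "\<lambda>(a, b). (2 * b, a)" and j = "\<lambda>(a, b). (b, a div 2)"])
       (auto simp: power2_eq_square algebra_simps)
  have sm: "(\<lambda>p. q ^ nat (g p)) summable_on UNIV"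
  proof (rule summable_qsum2[OF q])
    show "\<bar>m\<bar> + \<bar>n\<bar> \<le> g (m, n) + 2" for m n
      using abs_le_tri[of m] abs_le_tri[of n] tri_nonneg[of n] by (simp add: g_def)
  qed
  have eq: "g (k + 2 * b, k) = (2 * k + 1)\<^sup>2 + (2 * k + 1) * b + 2 * b\<^sup>2" for k b
    using two_tri[of k] two_tri[of "k + 2 * b"] by (simp add: g_def power2_eq_square algebra_simps)
  have 2: "qsum q g {p. even (fst p + snd p)} = qsum q ?f {p. \<not> even (fst p)}"
    by (rule qsum_reindex[where i = "\<lambda>(a, b). (a div 2 + 2 * b, a div 2)" and j = "\<lambda>(m, n). (2 * n + 1, (m - n) div 2)"])
       (auto simp: eq elim!: oddE)
  have 3: "qsum q g {p. \<not> even (fst p + snd p)} = qsum q g {p. even (fst p + snd p)}"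
    by (rule qsum_reindex[where i = "\<lambda>(m, n). (m, - 1 - n)" and j = "\<lambda>(m, n). (m, - 1 - n)"])
       (auto simp: g_def tri_reflect)
  have "qsum q g UNIV = qsum q (\<lambda>p. (case p of (m, n) \<Rightarrow> tri m + 7 * tri n) + int 1) UNIV"
    by (simp add: g_def case_prod_unfold)
  also have "\<dots> = q ^ 1 * qsum q (\<lambda>(m, n). tri m + 7 * tri n) UNIV"
    by (rule qsum_shift) (use tri_nonneg in auto)
  also have "\<dots> = 4 * q * (theta_psi q * theta_psi (q ^ 7))"
    using psi_psi[OF q, of 1 7] by simp
  finally have "2 * qsum q ?f {p. \<not> even (fst p)} = 4 * q * (theta_psi q * theta_psi (q ^ 7))"
    using qsum_split[OF sm, of "\<lambda>p. even (fst p + snd p)"] 2 3 by simp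
  then show ?thesis
    using qsum_split[OF form_summable, of "\<lambda>p. even (fst p)"] 1 by (simp add: binary_theta_def)
qed

end

section \<open>Guetzlaff's equation of degree 7\<close>

lemma theta_phi_dissect_minus:
  assumes "q \<noteq> 0" "norm q < 1"
  shows "theta_phi (- q) = theta_phi (q ^ 4) - 2 * q * theta_psi (q ^ 8)"
  using theta_phi_dissect[of "- q"] assms by simp

text \<open>Both sides equal phi(q^4)^2 - 4q^2 psi(q^8)^2: the left as a difference of squares, the
  right by expanding the dissection of phi(-q^2).\<close>

lemma theta_phi_mult_minus:
  assumes q: "q \<noteq> 0" "norm q < 1"
  shows "theta_phi q * theta_phi (- q) = (theta_phi (- (q\<^sup>2)))\<^sup>2"
proof -
  have nz: "q ^ k \<noteq> 0" and less: "0 < k \<Longrightarrow> norm (q ^ k) < 1" for k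
    using power_in_disc[OF q] by auto
  have "theta_phi (- (q\<^sup>2)) = theta_phi (q ^ 8) - 2 * q\<^sup>2 * theta_psi (q ^ 16)"
    using theta_phi_dissect_minus[OF nz less, of 2] by (simp add: power_mult[symmetric])
  moreover have "(theta_phi (q ^ 4))\<^sup>2 = (theta_phi (q ^ 8))\<^sup>2 + 4 * q ^ 4 * (theta_psi (q ^ 16))\<^sup>2"
    using theta_phi_square[OF nz less, of 4] by (simp add: power_mult[symmetric])
  moreover have "(theta_psi (q ^ 8))\<^sup>2 = theta_phi (q ^ 8) * theta_psi (q ^ 16)"
    using theta_psi_square[OF nz less, of 8] by (simp add: power_mult[symmetric])
  ultimately show ?thesis
    unfolding theta_phi_dissect[OF q] theta_phi_dissect_minus[OF q] by algebra
qed

lemma Guetzlaff_degree_7: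
  assumes q: "q \<noteq> 0" "norm q < 1"
  shows "theta_phi q * theta_phi (q ^ 7) - theta_phi (- (q\<^sup>2)) * theta_phi (- (q ^ 14))
    = 2 * q * (theta_psi q * theta_psi (q ^ 7))"
proof -
  have nz: "q ^ k \<noteq> 0" and less: "0 < k \<Longrightarrow> norm (q ^ k) < 1" for k
    using power_in_disc[OF q] by auto
  define Z H where "Z k = theta_phi (q ^ k) * theta_phi (q ^ (7 * k))"
    and "H k = q ^ k * (theta_psi (q ^ k) * theta_psi (q ^ (7 * k)))" for k
  have snd: "binary_theta (q ^ k) = Z k + 4 * H (2 * k)" if "0 < k" for k
    using binary_theta_parity_snd[OF nz less, OF that]
    by (simp add: Z_def H_def power_mult[symmetric] mult_ac)
  have fst: "binary_theta (q ^ k) = binary_theta (q ^ (2 * k)) + 2 * H k" if "0 < k" for k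
    using binary_theta_parity_fst[OF nz less, OF that]
    by (simp add: H_def power_mult[symmetric] mult_ac)
  \<comment> \<open>Write S_k for S(q^k). Then S_1 = S_2 + 2 H 1 and S_2 = S_8 + 2 H 2 + 2 H 4;
    inserting S_k = Z k + 4 H(2k) for k = 1, 2, 8 eliminates H 2 and H 4.\<close>
  have "Z 1 + Z 2 - 2 * Z 8 - 8 * H 16 = 2 * H 1"
    using snd[of 1] snd[of 2] snd[of 8] fst[of 1] fst[of 2] fst[of 4] by simp algebra
  \<comment> \<open>With X, Y the even parts and x, y the odd parts of phi(q^2), phi(q^14), this is
    (X-x)(Y-y) = 2XY + 2xy - (X+x)(Y+y).\<close>
  moreover have "theta_phi (- (q\<^sup>2)) * theta_phi (- (q ^ 14)) = 2 * Z 8 + 8 * H 16 - Z 2"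
  proof -
    have "theta_phi (- (q ^ k)) = theta_phi (q ^ (4 * k)) - 2 * q ^ k * theta_psi (q ^ (8 * k))"
      "theta_phi (q ^ k) = theta_phi (q ^ (4 * k)) + 2 * q ^ k * theta_psi (q ^ (8 * k))"
      if "0 < k" for k
      using theta_phi_dissect_minus[OF nz less, OF that] theta_phi_dissect[OF nz less, OF that]
      by (simp_all add: power_mult[symmetric] mult_ac)
    from this[of 2] this[of 14] show ?thesis
      by (simp add: Z_def H_def) (simp add: algebra_simps flip: power_add)
  qed
  ultimately have "Z 1 - theta_phi (- (q\<^sup>2)) * theta_phi (- (q ^ 14)) = 2 * H 1"
    by algebra
  then show ?thesis by (simp add: Z_def H_def mult_ac)
qed

section \<open>Non-vanishing of phi and psi\<close>

text \<open>The terms after the leading 1 are dominated by a geometric series with sum r/(1-r) < 1,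
  where r is the norm of q.\<close>

lemma theta_psi_nonzero_small:
  assumes "norm q < 1 / 2"
  shows "theta_psi q \<noteq> 0"
proof
  assume 0: "theta_psi q = 0"
  have "summable (\<lambda>n. norm q ^ n)"
    using assms by (intro summable_geometric) auto
  then have sm: "summable (\<lambda>n. norm q * norm q ^ n)"
    by (rule summable_mult)
  have le: "norm (q ^ (Suc n * (Suc n + 1) div 2)) \<le> norm q * norm q ^ n" for n
  proof -
    have "Suc n \<le> Suc n * (Suc n + 1) div 2" by (simp add: algebra_simps)
    then have "norm q ^ (Suc n * (Suc n + 1) div 2) \<le> norm q ^ Suc n"
      using assms by (intro power_decreasing) auto
    then show ?thesis unfolding norm_power power_Suc .
  qed
  have "summable (\<lambda>n. q ^ (Suc n * (Suc n + 1) div 2))"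
    by (rule summable_comparison_test[OF _ sm]) (use le in blast)
  then have "summable (\<lambda>n. q ^ (n * (n + 1) div 2))"
    by (subst (asm) summable_Suc_iff)
  from suminf_split_head[OF this]
  have "(\<Sum>n. q ^ (Suc n * (Suc n + 1) div 2)) = - 1"
    using 0 by (simp add: theta_psi_def)
  moreover have "norm (\<Sum>n. q ^ (Suc n * (Suc n + 1) div 2)) \<le> (\<Sum>n. norm q * norm q ^ n)"
    by (rule norm_suminf_le[OF le sm])
  moreover have "(\<Sum>n. norm q * norm q ^ n) = norm q * (1 / (1 - norm q))"
    using assms by (subst suminf_mult) (auto simp: suminf_geometric intro!: summable_geometric)
  ultimately show False using assms by (simp add: field_simps)
qed

lemma power_two_power_small:
  assumes "norm (q::complex) < 1"
  obtains n where "norm (q ^ (2 ^ n)) < 1 / 2"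
proof -
  obtain n where n: "norm q ^ n < 1 / 2"
    using real_arch_pow_inv[of "1/2" "norm q"] assms by auto
  have "norm q ^ (2 ^ n) \<le> norm q ^ n"
    using assms by (intro power_decreasing) (auto intro: less_imp_le less_exp)
  with n have "norm (q ^ (2 ^ n)) < 1 / 2" unfolding norm_power by linarith
  then show thesis by (rule that)
qed

text \<open>
  A zero would propagate along \<open>q, q\<^sup>2, q\<^sup>4, \<dots>\<close>, but there is none near the origin.
\<close>

lemma theta_phi_minus_nonzero:
  assumes q: "q \<noteq> 0" "norm q < 1"
  shows "theta_phi (- q) \<noteq> 0"
proof
  assume 0: "theta_phi (- q) = 0"
  have z: "theta_phi (- (q ^ (2 ^ n))) = 0" for n
  proof (induction n)
    case (Suc n)
    have "theta_phi (q ^ 2 ^ n) * theta_phi (- (q ^ 2 ^ n)) = (theta_phi (- ((q ^ 2 ^ n)\<^sup>2)))\<^sup>2"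
      by (rule theta_phi_mult_minus) (use power_in_disc[OF q, of "2 ^ n"] in auto)
    with Suc show ?case by (simp add: power_mult[symmetric] mult.commute)
  qed (use 0 in simp)
  obtain n where n: "norm (q ^ 2 ^ n) < 1 / 2"
    using power_two_power_small[OF q(2)] .
  \<comment> \<open>Non-vanishing near the origin is known for psi only; this identity turns a zero
    of phi into one of psi.\<close>
  have "(theta_psi (- (q ^ 2 ^ n)))\<^sup>2 = theta_phi (- (q ^ 2 ^ n)) * theta_psi ((- (q ^ 2 ^ n))\<^sup>2)"
    by (rule theta_psi_square) (use q n in auto)
  then show False
    using theta_psi_nonzero_small[of "- (q ^ 2 ^ n)"] n z by auto
qed

lemma theta_phi_nonzero:
  assumes "q \<noteq> 0" "norm q < 1"
  shows "theta_phi q \<noteq> 0"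
  using theta_phi_minus_nonzero[of "- q"] assms by simp

lemma theta_psi_nonzero:
  assumes q: "q \<noteq> 0" "norm q < 1"
  shows "theta_psi q \<noteq> 0"
proof
  assume 0: "theta_psi q = 0"
  have z: "theta_psi (q ^ (2 ^ n)) = 0" for n
  proof (induction n)
    case (Suc n)
    have "(theta_psi (q ^ 2 ^ n))\<^sup>2 = theta_phi (q ^ 2 ^ n) * theta_psi ((q ^ 2 ^ n)\<^sup>2)"
      by (rule theta_psi_square) (use power_in_disc[OF q, of "2 ^ n"] in auto)
    moreover have "theta_phi (q ^ 2 ^ n) \<noteq> 0"
      by (rule theta_phi_nonzero) (use power_in_disc[OF q, of "2 ^ n"] in auto)
    ultimately show ?case using Suc by (simp add: power_mult[symmetric] mult.commute)
  qed (use 0 in simp)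
  show False
    using power_two_power_small[OF q(2)] theta_psi_nonzero_small z by blast
qed


section \<open>The polynomial relation between P and Q\<close>

text \<open>Each quantity is a polynomial in P times a power of y, so that y cancels from
  homogeneous relations. The square and the eighth power are taken to avoid roots of such
  polynomials.\<close>

lemma theta_in_terms_of_ratio:
  assumes q: "q \<noteq> 0" "norm q < 1"
  defines "y \<equiv> q * theta_psi (q ^ 8)"
  defines "P \<equiv> theta_phi (- q) / y"
  shows "y \<noteq> 0" "P \<noteq> 0" "P + 4 \<noteq> 0"
    and "theta_phi q = (P + 4) * y"
    and "(theta_phi (- (q\<^sup>2)))\<^sup>2 = P * (P + 4) * y\<^sup>2"
    and "q * theta_psi q ^ 8 = (P + 4) ^ 4 * ((P + 2) * (P\<^sup>2 + 4 * P + 8)) * y ^ 8"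
proof -
  have nz: "q ^ k \<noteq> 0" and less: "0 < k \<Longrightarrow> norm (q ^ k) < 1" for k
    using power_in_disc[OF q] by auto
  show y: "y \<noteq> 0"
    using theta_psi_nonzero[OF nz less, of 8] q by (simp add: y_def)
  show "P \<noteq> 0"
    using theta_phi_minus_nonzero[OF q] y by (simp add: P_def)
  have minus: "theta_phi (- q) = P * y"
    using y by (simp add: P_def)
  have four: "theta_phi (q ^ 4) = (P + 2) * y"
    using theta_phi_dissect_minus[OF q] minus by (simp add: y_def algebra_simps)
  show one: "theta_phi q = (P + 4) * y"
    using theta_phi_dissect[OF q] four by (simp add: y_def algebra_simps)
  show "P + 4 \<noteq> 0"
    using one theta_phi_nonzero[OF q] by auto
  show "(theta_phi (- (q\<^sup>2)))\<^sup>2 = P * (P + 4) * y\<^sup>2"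
    using theta_phi_mult_minus[OF q] one minus by (simp add: power2_eq_square algebra_simps)
  have psi1: "(theta_psi q)\<^sup>2 = theta_phi q * theta_psi (q\<^sup>2)"
    by (rule theta_psi_square[OF q])
  have psi2: "(theta_psi (q\<^sup>2))\<^sup>2 = theta_phi (q\<^sup>2) * theta_psi (q ^ 4)"
    using theta_psi_square[OF nz less, of 2] by (simp add: power_mult[symmetric])
  have psi4: "(theta_psi (q ^ 4))\<^sup>2 = theta_phi (q ^ 4) * theta_psi (q ^ 8)"
    using theta_psi_square[OF nz less, of 4] by (simp add: power_mult[symmetric])
  \<comment> \<open>The polynomial arises as (P+4)^2 - 4(P+2).\<close>
  have two: "(theta_phi (q\<^sup>2))\<^sup>2 = (P\<^sup>2 + 4 * P + 8) * y\<^sup>2"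
    using theta_phi_square[OF q] psi4 four one unfolding y_def by algebra
  \<comment> \<open>Three doublings of the argument lead from psi(q) to psi(q^8), which the extra
    factor q turns into y.\<close>
  have "theta_psi q ^ 8 = theta_phi q ^ 4 * ((theta_phi (q\<^sup>2))\<^sup>2 * (theta_phi (q ^ 4) * theta_psi (q ^ 8)))"
    using psi1 psi2 psi4 by algebra
  then have "q * theta_psi q ^ 8 = theta_phi q ^ 4 * ((theta_phi (q\<^sup>2))\<^sup>2 * (theta_phi (q ^ 4) * y))"
    by (simp add: y_def)
  then show "q * theta_psi q ^ 8 = (P + 4) ^ 4 * ((P + 2) * (P\<^sup>2 + 4 * P + 8)) * y ^ 8"
    unfolding one two four by algebra
qed

text \<open>
  Here \<open>M\<close>, \<open>u\<close>, \<open>2h\<close> are the three terms of Guetzlaff's equation divided by a common factor.  The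
  dependence on the sign of \<open>u = \<surd>(M N)\<close> is removed by multiplying with the conjugate \<open>W'\<close> of \<open>W\<close>.
\<close>

lemma rationalise_eighth_power:
  fixes M N u h C :: complex
  assumes "M \<noteq> 0" and h: "M - u = 2 * h" and u: "u\<^sup>2 = M * N" and C: "h ^ 8 = M ^ 4 * C"
  shows "(M - N) ^ 8 = 256 * C * (2 * ((M + N) ^ 4 + 24 * (M + N)\<^sup>2 * (M * N) + 16 * (M * N)\<^sup>2) - 256 * C)"
proof -
  \<comment> \<open>If u is the product of roots of M and N, then W and W' are the squares of the
    difference and the sum of these roots.\<close>
  define W W' where "W = M + N - 2 * u" and "W' = M + N + 2 * u"
  have "M * W = (2 * h)\<^sup>2"
    unfolding W_def h[symmetric] using u by algebra
  then have "(M * W) ^ 4 = 256 * h ^ 8"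
    by (simp add: power_mult_distrib power_mult[symmetric])
  then have "M ^ 4 * W ^ 4 = M ^ 4 * (256 * C)"
    unfolding C by (simp add: power_mult_distrib)
  then have W: "W ^ 4 = 256 * C"
    using \<open>M \<noteq> 0\<close> by simp
  have "W * W' = (M - N)\<^sup>2"
    unfolding W_def W'_def using u by algebra
  then have "(M - N) ^ 8 = W ^ 4 * W' ^ 4"
    by (metis (no_types) mult_2 num_double numeral_times_numeral power_mult power_mult_distrib)
  \<comment> \<open>The sum is even in u, so only u^2 = M N enters.\<close>
  moreover have "W ^ 4 + W' ^ 4 = 2 * ((M + N) ^ 4 + 24 * (M + N)\<^sup>2 * (M * N) + 16 * (M * N)\<^sup>2)"
    unfolding W_def W'_def using u by algebra
  ultimately show ?thesis
    unfolding W by (metis add_diff_cancel_left')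
qed

lemma degree_7_polynomial:
  assumes q: "q \<noteq> 0" "norm q < 1"
  defines "P \<equiv> theta_phi (- q) / (q * theta_psi (q ^ 8))"
    and "Q \<equiv> theta_phi (- (q ^ 7)) / (q ^ 7 * theta_psi (q ^ 56))"
  defines "M \<equiv> (P + 4) * (Q + 4)" and "N \<equiv> P * Q"
    and "C \<equiv> (P + 2) * (P\<^sup>2 + 4 * P + 8) * ((Q + 2) * (Q\<^sup>2 + 4 * Q + 8))"
  shows "P \<noteq> 0" "Q \<noteq> 0"
    and "(M - N) ^ 8 = 256 * C * (2 * ((M + N) ^ 4 + 24 * (M + N)\<^sup>2 * (M * N) + 16 * (M * N)\<^sup>2) - 256 * C)"
proof -
  define y z where "y = q * theta_psi (q ^ 8)" and "z = q ^ 7 * theta_psi (q ^ 56)"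
  have q7: "q ^ 7 \<noteq> 0" "norm (q ^ 7) < 1"
    using power_in_disc[OF q, of 7] by auto
  have pow: "(q ^ 7) ^ 8 = q ^ 56" "(q ^ 7)\<^sup>2 = q ^ 14"
    by (simp_all add: power_mult[symmetric])
  note p = theta_in_terms_of_ratio[OF q, folded P_def, folded y_def]
  note r = theta_in_terms_of_ratio[OF q7, unfolded pow, folded Q_def, folded z_def]
  show "P \<noteq> 0" "Q \<noteq> 0" by (fact p(2) r(2))+
  define u h where "u = theta_phi (- (q\<^sup>2)) * theta_phi (- (q ^ 14)) / (y * z)"
    and "h = q * (theta_psi q * theta_psi (q ^ 7)) / (y * z)"
  have "M = theta_phi q * theta_phi (q ^ 7) / (y * z)"
    using p r by (simp add: M_def)
  then have "M - u = (theta_phi q * theta_phi (q ^ 7) - theta_phi (- (q\<^sup>2)) * theta_phi (- (q ^ 14))) / (y * z)"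
    by (simp add: u_def diff_divide_distrib)
  then have h: "M - u = 2 * h"
    unfolding Guetzlaff_degree_7[OF q] by (simp add: h_def)
  have u: "u\<^sup>2 = M * N"
    using p r by (simp add: u_def M_def N_def power_divide power_mult_distrib field_simps)
  \<comment> \<open>The factor q^8 splits as q times q^7, one for each eighth-power formula.\<close>
  have "h ^ 8 = (q * theta_psi q ^ 8) * (q ^ 7 * theta_psi (q ^ 7) ^ 8) / (y * z) ^ 8"
    by (simp add: h_def power_divide power_mult_distrib)
       (simp add: power_Suc[symmetric] mult_ac flip: power_add)
  also have "\<dots> = M ^ 4 * C"
    unfolding p(6) r(6) using p(1) r(1) by (simp add: M_def C_def power_mult_distrib mult_ac)
  finally have C: "h ^ 8 = M ^ 4 * C" .
  have "M \<noteq> 0" using p r by (simp add: M_def)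
  from rationalise_eighth_power[OF this h u C]
  show "(M - N) ^ 8 = 256 * C * (2 * ((M + N) ^ 4 + 24 * (M + N)\<^sup>2 * (M * N) + 16 * (M * N)\<^sup>2) - 256 * C)" .
qed

section \<open>Translation into A_7 and B_7\<close>

text \<open>For odd i, j the product a^i b^j is P^((i+j)/2) Q^((i-j)/2), so the square roots leave
  only integral powers of P and Q.\<close>

lemma sums_in_ratio_terms:
  fixes a b :: complex
  assumes "a \<noteq> 0" "b \<noteq> 0" and P: "P = a * b" and Q: "Q = a / b"
  shows "(a + 8 / a) * (b + 1 / b) = P + Q + 8 / P + 8 / Q"
    and "(a + 8 / a) * (b ^ 3 + 1 / b ^ 3) = P\<^sup>2 / Q + Q\<^sup>2 / P + 8 * P / Q\<^sup>2 + 8 * Q / P\<^sup>2"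
    and "(a + 8 / a) * (b ^ 5 + 1 / b ^ 5) = P ^ 3 / Q\<^sup>2 + Q ^ 3 / P\<^sup>2 + 8 * P\<^sup>2 / Q ^ 3 + 8 * Q\<^sup>2 / P ^ 3"
    and "(a ^ 3 + 8 ^ 3 / a ^ 3) * (b + 1 / b) = P\<^sup>2 * Q + P * Q\<^sup>2 + 8 ^ 3 / (P * Q\<^sup>2) + 8 ^ 3 / (P\<^sup>2 * Q)"
    and "(a ^ 3 + 8 ^ 3 / a ^ 3) * (b ^ 3 + 1 / b ^ 3) = P ^ 3 + Q ^ 3 + 8 ^ 3 / P ^ 3 + 8 ^ 3 / Q ^ 3"
    and "(a ^ 5 + 8 ^ 5 / a ^ 5) * (b + 1 / b)
      = P ^ 3 * Q\<^sup>2 + P\<^sup>2 * Q ^ 3 + 8 ^ 5 / (P ^ 3 * Q\<^sup>2) + 8 ^ 5 / (P\<^sup>2 * Q ^ 3)"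
  unfolding P Q using assms(1,2)
  by (simp_all add: field_simps eval_nat_numeral)

lemma clear_denominators:
  fixes P Q :: complex
  assumes "P \<noteq> 0" "Q \<noteq> 0"
  defines "A \<equiv> P * Q" and "B \<equiv> P / Q"
  defines "M \<equiv> (P + 4) * (Q + 4)" and "N \<equiv> P * Q"
    and "C \<equiv> (P + 2) * (P\<^sup>2 + 4 * P + 8) * ((Q + 2) * (Q\<^sup>2 + 4 * Q + 8))"
  assumes eq: "(M - N) ^ 8 = 256 * C * (2 * ((M + N) ^ 4 + 24 * (M + N)\<^sup>2 * (M * N) + 16 * (M * N)\<^sup>2) - 256 * C)"
  shows "B ^ 4 + 1 / B ^ 4 =
      280 * (B ^ 3 + 1 / B ^ 3)
    + 9772 * (B ^ 2 + 1 / B ^ 2)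
    + 60424 * (B + 1 / B)
    + (A ^ 3 + 8 ^ 6 / A ^ 3)
    + (A ^ 2 + 8 ^ 4 / A ^ 2) * (203 + 84 * (B + 1 / B))
    + 28 * (1030 * (P + Q + 8 / P + 8 / Q)
        + 313 * (P\<^sup>2 / Q + Q\<^sup>2 / P + 8 * P / Q\<^sup>2 + 8 * Q / P\<^sup>2)
        + 21 * (P ^ 3 / Q\<^sup>2 + Q ^ 3 / P\<^sup>2 + 8 * P\<^sup>2 / Q ^ 3 + 8 * Q\<^sup>2 / P ^ 3))
    + 140 * (9 * (P\<^sup>2 * Q + P * Q\<^sup>2 + 8 ^ 3 / (P * Q\<^sup>2) + 8 ^ 3 / (P\<^sup>2 * Q))
        + 2 * (P ^ 3 + Q ^ 3 + 8 ^ 3 / P ^ 3 + 8 ^ 3 / Q ^ 3))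
    + (A + 8 ^ 2 / A) * (8092 + 4340 * (B + 1 / B) + 546 * (B ^ 2 + 1 / B ^ 2))
    + 14 * (P ^ 3 * Q\<^sup>2 + P\<^sup>2 * Q ^ 3 + 8 ^ 5 / (P ^ 3 * Q\<^sup>2) + 8 ^ 5 / (P\<^sup>2 * Q ^ 3))
    + 106330" (is "?l = ?r")
proof -
  \<comment> \<open>P^4 Q^4 clears all denominators and turns B^4 into P^8; 65536 = 4^8 is the
    coefficient of P^8 in (M-N)^8, as M - N = 4(P+Q+4).\<close>
  have "65536 * P ^ 4 * Q ^ 4 * (?l - ?r) = (M - N) ^ 8
    - 256 * C * (2 * ((M + N) ^ 4 + 24 * (M + N)\<^sup>2 * (M * N) + 16 * (M * N)\<^sup>2) - 256 * C)"
    unfolding A_def B_def M_def N_def C_def using assms(1,2)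
    by (simp add: divide_simps) algebra
  then show ?thesis using eq assms(1,2) by simp
qed

theorem theorem3p6:
  fixes q sA sB :: complex
  assumes "0 < norm q" and "norm q < 1"
    and "admissible_roots q sA sB"
  shows "B7 q ^ 4 + 1 / B7 q ^ 4 =
      280 * (B7 q ^ 3 + 1 / B7 q ^ 3)
    + 9772 * (B7 q ^ 2 + 1 / B7 q ^ 2)
    + 60424 * (B7 q + 1 / B7 q)
    + (A7 q ^ 3 + 8 ^ 6 / A7 q ^ 3)
    + (A7 q ^ 2 + 8 ^ 4 / A7 q ^ 2) * (203 + 84 * (B7 q + 1 / B7 q))
    + 28 * (sA + 8 / sA)
        * (1030 * (sB + 1 / sB) + 313 * (sB ^ 3 + 1 / sB ^ 3) + 21 * (sB ^ 5 + 1 / sB ^ 5))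
    + 140 * (sA ^ 3 + 8 ^ 3 / sA ^ 3) * (9 * (sB + 1 / sB) + 2 * (sB ^ 3 + 1 / sB ^ 3))
    + (A7 q + 8 ^ 2 / A7 q)
        * (8092 + 4340 * (B7 q + 1 / B7 q) + 546 * (B7 q ^ 2 + 1 / B7 q ^ 2))
    + 14 * (sA ^ 5 + 8 ^ 5 / sA ^ 5) * (sB + 1 / sB)
    + 106330"
proof -
  have q: "q \<noteq> 0" "norm q < 1" using assms by auto
  define P Q where "P = theta_phi (- q) / (q * theta_psi (q ^ 8))"
    and "Q = theta_phi (- (q ^ 7)) / (q ^ 7 * theta_psi (q ^ 56))"
  note poly = degree_7_polynomial[OF q, folded P_def Q_def]
  have A: "A7 q = P * Q"
    by (simp add: A7_def P_def Q_def power_Suc[symmetric] mult_ac flip: power_add)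
  have "q ^ 7 = q * q ^ 6"
    by (simp flip: power_Suc)
  then have B: "B7 q = P / Q"
    using q by (simp add: B7_def P_def Q_def power_int_minus field_simps)
  have sA: "sA\<^sup>2 = P * Q" and P: "P = sA * sB"
    using assms(3) A by (simp_all add: admissible_roots_def P_def)
  have nz: "sA \<noteq> 0" "sB \<noteq> 0"
    using P poly(1) by auto
  \<comment> \<open>The prescribed product of the roots is P; cancelling \<open>sA\<close> in
    \<open>sA\<^sup>2 = P * Q\<close> then determines Q.\<close>
  have "sA * sA = sA * (sB * Q)"
    using sA unfolding P by (simp add: power2_eq_square)
  then have Q: "Q = sA / sB"
    using nz by (simp add: field_simps)
  \<comment> \<open>Regroups the right-hand side so that the products of
    \<open>sums_in_ratio_terms\<close> appear literally.\<close>
  have distrib: "28 * x * (1030 * a + 313 * b + 21 * c) = 28 * (1030 * (x * a) + 313 * (x * b) + 21 * (x * c))"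
    "140 * x * (9 * a + 2 * b) = 140 * (9 * (x * a) + 2 * (x * b))"
    "14 * x * a = 14 * (x * a)" for x a b c :: complex
    by algebra+
  show ?thesis
    unfolding distrib sums_in_ratio_terms[OF nz P Q] A B
    by (rule clear_denominators[OF poly])
qed

end
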